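(* Thompson's group $F$ does not satisfy an identity; that is, for every positive integer $n$ and every non-trivial reduced word $w(x_1,\dots,x_n)$ there exist $a_1,\dots,a_n\in F$ such that $w(a_1,\dots,a_n)\neq 1$.
   Context: Thompson's group $F$ is the group (under composition) of all piecewise linear orientation-preserving homeomorphisms of the unit interval $[0,1]$ with finitely many breakpoints such that all slopes are powers of $2$ (integer exponents) and all breakpoints lie in $\mathbb{Z}[\frac12]$, the ring of dyadic rational numbers. A group $G$ satisfies an identity $w$ in $n$ variables, where $w(x_1,\dots,x_n)$ is a non-trivial reduced word (a non-trivial element of the free group on $x_1,\dots,x_n$), if $w(g_1,\dots,g_n)=1$ for all $g_1,\dots,g_n\in G$. *)

theory Defs
  imports "HOL-Analysis.Analysis" "HOL-Algebra.Bij"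
begin

section \<open>Thompson's group F\<close>

definition dyadic_rationals :: "real set" where
  "dyadic_rationals = {x. \<exists>(m::int) (n::nat). x = of_int m / 2 ^ n}"

text \<open>
  The finite set \<open>B\<close> below may contain points at which the slope does not change;
  it has to contain every breakpoint of \<open>f\<close>.
\<close>

definition dyadic_piecewise_linear :: "(real \<Rightarrow> real) \<Rightarrow> bool" where
  "dyadic_piecewise_linear f \<longleftrightarrow>
     (\<exists>B. finite B \<and> B \<subseteq> dyadic_rationals \<and>
        (\<forall>a b. 0 \<le> a \<and> a < b \<and> b \<le> 1 \<and> {a<..<b} \<inter> B = {} \<longrightarrow>
           (\<exists>(k::int) c. \<forall>x\<in>{a..b}. f x = 2 powi k * x + c)))"

text \<open>
  A self-map of the unit interval is represented by a function that is \<open>undefined\<close>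
  outside of it, as everywhere in \<^term>\<open>Bij\<close>. The product in \<^term>\<open>BijGroup\<close> is
  composition, the right factor being applied first.
\<close>

definition thompson_F_set :: "(real \<Rightarrow> real) set" where
  "thompson_F_set =
     {f \<in> Bij {0..1}. (\<exists>g. homeomorphism {0..1} {0..1} f g) \<and>
        strict_mono_on {0..1} f \<and> dyadic_piecewise_linear f}"

definition thompson_F :: "(real \<Rightarrow> real) monoid" where
  "thompson_F = (BijGroup {0..1})\<lparr>carrier := thompson_F_set\<rparr>"

lemma dyadic_add:
  assumes "x \<in> dyadic_rationals" "y \<in> dyadic_rationals"
  shows "x + y \<in> dyadic_rationals"
proof -
  obtain m n p q where "x = of_int m / 2 ^ n" "y = of_int p / 2 ^ q"
    using assms by (auto simp: dyadic_rationals_def)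
  then have "x + y = of_int (m * 2 ^ q + p * 2 ^ n) / 2 ^ (n + q)"
    by (simp add: add_divide_distrib power_add)
  then show ?thesis unfolding dyadic_rationals_def by blast
qed

lemma dyadic_minus: "x \<in> dyadic_rationals \<Longrightarrow> - x \<in> dyadic_rationals"
  unfolding dyadic_rationals_def
  by clarsimp (metis minus_divide_left of_int_minus)

lemma dyadic_powi_mult:
  assumes "x \<in> dyadic_rationals"
  shows "2 powi k * x \<in> dyadic_rationals"
proof -
  obtain m n where x: "x = of_int m / 2 ^ n"
    using assms by (auto simp: dyadic_rationals_def)
  show ?thesis
  proof (cases "k \<ge> 0")
    case True
    then have "2 powi k * x = of_int (2 ^ nat k * m) / 2 ^ n"
      by (simp add: x power_int_def)
    then show ?thesis unfolding dyadic_rationals_def by blast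
  next
    case False
    then have "2 powi k * x = of_int m / 2 ^ (n + nat (- k))"
      by (simp add: x power_int_def power_add field_simps)
    then show ?thesis unfolding dyadic_rationals_def by blast
  qed
qed

lemma dyadic_powi_mult_iff:
  "2 powi k * x \<in> dyadic_rationals \<longleftrightarrow> x \<in> dyadic_rationals"
proof
  assume "2 powi k * x \<in> dyadic_rationals"
  from dyadic_powi_mult[OF this, of "- k"] show "x \<in> dyadic_rationals"
    by (simp add: mult.assoc[symmetric] power_int_minus)
qed (rule dyadic_powi_mult)

lemma dyadic_add_iff:
  assumes "x \<in> dyadic_rationals"
  shows "x + y \<in> dyadic_rationals \<longleftrightarrow> y \<in> dyadic_rationals"
  using dyadic_add[OF assms, of y] dyadic_add[OF dyadic_minus[OF assms], of "x + y"] by auto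

lemma thompson_F_zero:
  assumes "f \<in> thompson_F_set"
  shows "f 0 = 0"
proof -
  have b: "f ` {0..1} = {0..1}" and m: "strict_mono_on {0..1} f"
    using assms by (auto simp: thompson_F_set_def Bij_def bij_betw_def)
  obtain x where x: "x \<in> {0..1}" "f x = 0" using b
    by (metis atLeastAtMost_iff imageE order_refl zero_le_one)
  have "f 0 \<ge> 0" using b by (metis atLeastAtMost_iff image_eqI order_refl zero_le_one)
  show ?thesis
  proof (cases "x = 0")
    case False
    with x have "f 0 < f x" using strict_mono_onD[OF m, of 0 x] by simp
    with x \<open>f 0 \<ge> 0\<close> show ?thesis by simp
  qed (use x in simp)
qed

lemma dyadic_piecewise_linearI:
  assumes "finite B" "B \<subseteq> dyadic_rationals"
    "\<And>a b. 0 \<le> a \<Longrightarrow> a < b \<Longrightarrow> b \<le> 1 \<Longrightarrow> {a<..<b} \<inter> B = {} \<Longrightarrow>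
      \<exists>(k::int) c. \<forall>x\<in>{a..b}. f x = 2 powi k * x + c"
  shows "dyadic_piecewise_linear f"
  unfolding dyadic_piecewise_linear_def
proof (intro exI[of _ B] conjI allI impI)
  fix a b :: real
  assume "0 \<le> a \<and> a < b \<and> b \<le> 1 \<and> {a<..<b} \<inter> B = {}"
  then show "\<exists>(k::int) c. \<forall>x\<in>{a..b}. f x = 2 powi k * x + c"
    by (elim conjE) (rule assms(3))
qed (fact assms)+

lemma thompson_F_affine_pieces:
  assumes "f \<in> thompson_F_set"
  shows "\<exists>B. finite B \<and> B \<subseteq> dyadic_rationals \<and>
    (\<forall>a b. 0 \<le> a \<longrightarrow> a < b \<longrightarrow> b \<le> 1 \<longrightarrow> {a<..<b} \<inter> B = {} \<longrightarrow>
      (\<exists>(k::int) c. \<forall>x\<in>{a..b}. f x = 2 powi k * x + c))"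
  using assms unfolding thompson_F_set_def dyadic_piecewise_linear_def
  by (simp only: mem_Collect_eq conj_imp_eq_imp_imp imp_conjL)

lemma thompson_F_dyadic_iff:
  assumes f: "f \<in> thompson_F_set" and "x \<in> {0..1}"
  shows "f x \<in> dyadic_rationals \<longleftrightarrow> x \<in> dyadic_rationals"
proof -
  obtain B where B: "finite B" "B \<subseteq> dyadic_rationals"
    and lin[rule_format]: "\<forall>a b. 0 \<le> a \<longrightarrow> a < b \<longrightarrow> b \<le> 1 \<longrightarrow> {a<..<b} \<inter> B = {} \<longrightarrow>
      (\<exists>(k::int) c. \<forall>x\<in>{a..b}. f x = 2 powi k * x + c)"
    using thompson_F_affine_pieces[OF f] by (elim exE conjE)
  have z: "(0::real) \<in> dyadic_rationals"
    unfolding dyadic_rationals_def by (auto intro: exI[of _ 0])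
  show ?thesis using \<open>x \<in> {0..1}\<close>
  proof (induction "card (B \<inter> {0<..<x})" arbitrary: x rule: less_induct)
    case less
    define C where "C = insert 0 (B \<inter> {0<..<x})"
    show ?case
    proof (cases "x = 0")
      case True
      then show ?thesis using z thompson_F_zero[OF f] by simp
    next
      case False
      have C: "finite C" "C \<noteq> {}" using B by (auto simp: C_def)
      define m where "m = Max C"
      have mC: "m \<in> C" unfolding m_def using C by (rule Max_in)
      then have m: "0 \<le> m" "m < x" "m \<in> dyadic_rationals"
        using False less.prems B z by (auto simp: C_def)
      have fm: "f m \<in> dyadic_rationals"
      proof (cases "m = 0")
        case True
        then show ?thesis using z thompson_F_zero[OF f] by simp
      next
        case False
        then have "B \<inter> {0<..<m} \<subset> B \<inter> {0<..<x}" using mC m by (auto simp: C_def)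
        then have "card (B \<inter> {0<..<m}) < card (B \<inter> {0<..<x})"
          using B by (intro psubset_card_mono) auto
        from less.hyps[OF this] m less.prems show ?thesis by auto
      qed
      have "{m<..<x} \<inter> B = {}"
      proof -
        have "b \<le> m" if "b \<in> B" "m < b" "b < x" for b
          unfolding m_def using that m C by (intro Max_ge) (auto simp: C_def)
        then show ?thesis by fastforce
      qed
      with lin[of m x] m less.prems obtain k c
        where kc: "\<And>y. y \<in> {m..x} \<Longrightarrow> f y = 2 powi k * y + c" by auto
      have "f x = f m + 2 powi k * (- m + x)"
        using kc[of m] kc[of x] m by (simp add: algebra_simps)
      then show ?thesis
        using dyadic_add_iff[OF fm] dyadic_powi_mult_iff dyadic_add_iff[OF dyadic_minus[OF m(3)]]
        by metis
    qed
  qed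
qed

lemma thompson_F_compose:
  assumes g: "g \<in> thompson_F_set" and f: "f \<in> thompson_F_set"
  shows "compose {0..1} g f \<in> thompson_F_set"
proof -
  have fI: "f x \<in> {0..1}" if "x \<in> {0..1}" for x
    using f that Bij_imp_funcset by (fastforce simp: thompson_F_set_def)
  have fm: "strict_mono_on {0..1} f" and gm: "strict_mono_on {0..1} g"
    and fB: "f \<in> Bij {0..1}" and gB: "g \<in> Bij {0..1}"
    using f g by (auto simp: thompson_F_set_def)
  obtain f' g' where "homeomorphism {0..1} {0..1} f f'" "homeomorphism {0..1} {0..1} g g'"
    using f g by (auto simp: thompson_F_set_def)
  then have "homeomorphism {0..1} {0..1} (g \<circ> f) (f' \<circ> g')"
    by (rule homeomorphism_compose)
  then have 1: "homeomorphism {0..1} {0..1} (compose {0..1} g f) (f' \<circ> g')"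
    by (rule homeomorphism_cong) (auto simp: compose_def)
  have 2: "strict_mono_on {0..1} (compose {0..1} g f)"
    using fm gm fI by (auto simp: strict_mono_on_def compose_def)
  obtain B where B: "finite B" "B \<subseteq> dyadic_rationals"
    and linf[rule_format]: "\<forall>a b. 0 \<le> a \<longrightarrow> a < b \<longrightarrow> b \<le> 1 \<longrightarrow> {a<..<b} \<inter> B = {} \<longrightarrow>
      (\<exists>(k::int) c. \<forall>x\<in>{a..b}. f x = 2 powi k * x + c)"
    using thompson_F_affine_pieces[OF f] by (elim exE conjE)
  obtain D where D: "finite D" "D \<subseteq> dyadic_rationals"
    and ling[rule_format]: "\<forall>a b. 0 \<le> a \<longrightarrow> a < b \<longrightarrow> b \<le> 1 \<longrightarrow> {a<..<b} \<inter> D = {} \<longrightarrow>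
      (\<exists>(k::int) c. \<forall>x\<in>{a..b}. g x = 2 powi k * x + c)"
    using thompson_F_affine_pieces[OF g] by (elim exE conjE)
  define E where "E = B \<union> {x \<in> {0..1}. f x \<in> D}"
  have "inj_on f {0..1}" using fB by (auto simp: Bij_def bij_betw_def)
  then have "finite {x \<in> {0..1}. f x \<in> D}"
    using finite_inverse_image_gen[OF D(1)] by blast
  then have "finite E" using B by (simp add: E_def)
  moreover have "E \<subseteq> dyadic_rationals"
    using B D thompson_F_dyadic_iff[OF f] by (auto simp: E_def)
  moreover have "\<exists>(k::int) c. \<forall>x\<in>{a..b}. compose {0..1} g f x = 2 powi k * x + c"
    if ab: "0 \<le> a" "a < b" "b \<le> 1" "{a<..<b} \<inter> E = {}" for a b
  proof -
    have "{a<..<b} \<inter> B = {}" using ab by (auto simp: E_def)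
    with linf[of a b] ab obtain k c where k: "\<And>x. x \<in> {a..b} \<Longrightarrow> f x = 2 powi k * x + c" by blast
    have fab: "f a < f b" using fm ab by (auto simp: strict_mono_on_def)
    have "{f a<..<f b} \<inter> D = {}"
    proof (rule ccontr)
      assume "{f a<..<f b} \<inter> D \<noteq> {}"
      then obtain y where y: "f a < y" "y < f b" "y \<in> D" by auto
      have "f a \<in> {0..1}" "f b \<in> {0..1}" using fI ab by auto
      then have "y \<in> f ` {0..1}" using fB y by (auto simp: Bij_def bij_betw_def)
      then obtain x where x: "x \<in> {0..1}" "y = f x" by auto
      have "a < x" "x < b"
        using fm x y ab strict_mono_on_less[OF fm, of a x] strict_mono_on_less[OF fm, of x b] by auto
      with x y ab show False by (auto simp: E_def)
    qed
    with ling[of "f a" "f b"] fab fI[of a] fI[of b] ab obtain l d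
      where l: "\<And>y. y \<in> {f a..f b} \<Longrightarrow> g y = 2 powi l * y + d" by fastforce
    have "compose {0..1} g f x = 2 powi (l + k) * x + (2 powi l * c + d)" if "x \<in> {a..b}" for x
    proof -
      have "f x \<in> {f a..f b}" using that fm ab
        strict_mono_on_leD[OF fm, of a x] strict_mono_on_leD[OF fm, of x b] by auto
      with l k[OF that] that ab show ?thesis
        by (auto simp: compose_def power_int_add algebra_simps)
    qed
    then show ?thesis by blast
  qed
  ultimately have "dyadic_piecewise_linear (compose {0..1} g f)"
    by (rule dyadic_piecewise_linearI)
  with 1 2 compose_Bij[OF gB fB] show ?thesis by (auto simp: thompson_F_set_def)
qed

lemma thompson_F_inverse:
  assumes f: "f \<in> thompson_F_set"
  shows "(\<lambda>x\<in>{0..1}. inv_into {0..1} f x) \<in> thompson_F_set"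
proof -
  define h where "h = (\<lambda>x\<in>{0..1}. inv_into {0..1} f x)"
  have fm: "strict_mono_on {0..1} f" and fB: "f \<in> Bij {0..1}"
    using f by (auto simp: thompson_F_set_def)
  have im: "f ` {0..1} = {0..1}" and inj: "inj_on f {0..1}"
    using fB by (auto simp: Bij_def bij_betw_def)
  have hI: "h y \<in> {0..1}" "f (h y) = y" if "y \<in> {0..1}" for y
    using that im inv_into_into[of y f "{0..1}"] f_inv_into_f[of y f "{0..1}"]
    by (auto simp: h_def)
  have hm: "h x < h y \<longleftrightarrow> x < y" if "x \<in> {0..1}" "y \<in> {0..1}" for x y
    using strict_mono_on_less[OF fm hI(1)[OF that(1)] hI(1)[OF that(2)]] hI(2) that by simp
  obtain f' where f': "homeomorphism {0..1} {0..1} f f'"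
    using f by (auto simp: thompson_F_set_def)
  have "homeomorphism {0..1} {0..1} h f"
  proof (rule homeomorphism_cong[OF homeomorphism_symD[OF f']])
    show "h x = f' x" if "x \<in> {0..1}" for x
      using f' hI[OF that] by (metis homeomorphism_def)
  qed simp_all
  moreover have "strict_mono_on {0..1} h" using hm by (auto simp: strict_mono_on_def)
  moreover have "dyadic_piecewise_linear h"
  proof -
    obtain B where B: "finite B" "B \<subseteq> dyadic_rationals"
      and linf[rule_format]: "\<forall>a b. 0 \<le> a \<longrightarrow> a < b \<longrightarrow> b \<le> 1 \<longrightarrow> {a<..<b} \<inter> B = {} \<longrightarrow>
      (\<exists>(k::int) c. \<forall>x\<in>{a..b}. f x = 2 powi k * x + c)"
      using thompson_F_affine_pieces[OF f] by (elim exE conjE)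
    define E where "E = f ` (B \<inter> {0..1})"
    have "finite E" "E \<subseteq> dyadic_rationals"
      using B thompson_F_dyadic_iff[OF f] by (auto simp: E_def)
    moreover have "\<exists>(k::int) c. \<forall>x\<in>{a..b}. h x = 2 powi k * x + c"
      if ab: "0 \<le> a" "a < b" "b \<le> 1" "{a<..<b} \<inter> E = {}" for a b
    proof -
      have abI: "a \<in> {0..1}" "b \<in> {0..1}" using ab by auto
      have "{h a<..<h b} \<inter> B = {}"
      proof (rule ccontr)
        assume "{h a<..<h b} \<inter> B \<noteq> {}"
        then obtain x where x: "h a < x" "x < h b" "x \<in> B" by auto
        with hI(1)[OF abI(1)] hI(1)[OF abI(2)] have xI: "x \<in> {0..1}" by auto
        have "a < f x" "f x < b"
          using strict_mono_on_less[OF fm hI(1)[OF abI(1)] xI]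
            strict_mono_on_less[OF fm xI hI(1)[OF abI(2)]] x hI(2) abI by auto
        with x xI ab show False by (auto simp: E_def)
      qed
      with linf[of "h a" "h b"] hm[OF abI] ab hI(1)[OF abI(1)] hI(1)[OF abI(2)] obtain k c
        where k: "\<And>x. x \<in> {h a..h b} \<Longrightarrow> f x = 2 powi k * x + c" by fastforce
      have "h y = 2 powi (- k) * y + (- (2 powi (- k) * c))" if "y \<in> {a..b}" for y
      proof -
        have y: "y \<in> {0..1}" using that ab by auto
        have "h y \<in> {h a..h b}"
          using hm[OF y abI(1)] hm[OF abI(2) y] that by (auto simp: not_less[symmetric])
        from k[OF this] hI(2)[OF y] show ?thesis
          by (simp add: power_int_minus field_simps)
      qed
      then show ?thesis by blast
    qed
    ultimately show ?thesis by (rule dyadic_piecewise_linearI)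
  qed
  moreover have "h \<in> Bij {0..1}" unfolding h_def using fB by (rule restrict_inv_into_Bij)
  ultimately show ?thesis unfolding h_def thompson_F_set_def by blast
qed

lemma thompson_F_id: "(\<lambda>x\<in>{0..1}. x) \<in> thompson_F_set"
proof -
  have "homeomorphism {0..1} {0..1} (\<lambda>x\<in>{0..1::real}. x) (\<lambda>x. x)"
    by (rule homeomorphism_cong[of _ _ "\<lambda>x. x" "\<lambda>x. x"]) (auto simp: homeomorphism_def)
  moreover have "dyadic_piecewise_linear (\<lambda>x\<in>{0..1}. x)"
    unfolding dyadic_piecewise_linear_def
    by (rule exI[of _ "{}"]) (auto intro!: exI[of _ 0])
  moreover have "strict_mono_on {0..1} (\<lambda>x\<in>{0..1::real}. x)"
    by (auto simp: strict_mono_on_def)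
  ultimately show ?thesis using id_Bij by (auto simp: thompson_F_set_def)
qed

lemma subgroup_thompson_F: "subgroup thompson_F_set (BijGroup {0..1})"
proof (rule subgroup.intro)
  show "thompson_F_set \<subseteq> carrier (BijGroup {0..1})"
    by (auto simp: thompson_F_set_def BijGroup_def)
next
  fix x y assume xy: "x \<in> thompson_F_set" "y \<in> thompson_F_set"
  then have "x \<in> Bij {0..1}" "y \<in> Bij {0..1}" by (auto simp: thompson_F_set_def)
  with thompson_F_compose[OF xy] show "x \<otimes>\<^bsub>BijGroup {0..1}\<^esub> y \<in> thompson_F_set"
    by (simp add: BijGroup_def)
next
  show "\<one>\<^bsub>BijGroup {0..1}\<^esub> \<in> thompson_F_set"
    using thompson_F_id by (simp add: BijGroup_def)
next
  fix x assume x: "x \<in> thompson_F_set"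
  then have "x \<in> Bij {0..1}" by (auto simp: thompson_F_set_def)
  then show "inv\<^bsub>BijGroup {0..1}\<^esub> x \<in> thompson_F_set"
    using thompson_F_inverse[OF x] by (simp only: inv_BijGroup)
qed

theorem group_thompson_F: "group thompson_F"
  unfolding thompson_F_def
  using subgroup.subgroup_is_group[OF subgroup_thompson_F group_BijGroup] .


section \<open>Words and identities\<close>

text \<open>
  The letter \<open>(i, True)\<close> stands for the variable \<open>x\<^sub>i\<close> and \<open>(i, False)\<close> for its formal
  inverse. A non-trivial element of the free group on \<open>x\<^sub>1, \<dots>, x\<^sub>n\<close> is given by its
  unique reduced word, which is non-empty.
\<close>

type_synonym word = "(nat \<times> bool) list"

definition reduced :: "word \<Rightarrow> bool" where
  "reduced w \<longleftrightarrow> successively (\<lambda>l m. \<not> (fst l = fst m \<and> snd l \<noteq> snd m)) w"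

definition nontrivial_reduced_word :: "nat \<Rightarrow> word \<Rightarrow> bool" where
  "nontrivial_reduced_word n w \<longleftrightarrow> w \<noteq> [] \<and> fst ` set w \<subseteq> {1..n} \<and> reduced w"

fun word_value :: "('g, 'r) monoid_scheme \<Rightarrow> (nat \<Rightarrow> 'g) \<Rightarrow> word \<Rightarrow> 'g" where
  "word_value G a [] = \<one>\<^bsub>G\<^esub>"
| "word_value G a ((i, e) # w) =
     (if e then a i else inv\<^bsub>G\<^esub> (a i)) \<otimes>\<^bsub>G\<^esub> word_value G a w"

definition satisfies_identity :: "('g, 'r) monoid_scheme \<Rightarrow> nat \<Rightarrow> word \<Rightarrow> bool" where
  "satisfies_identity G n w \<longleftrightarrow>
     (\<forall>g \<in> {1..n} \<rightarrow> carrier G. word_value G g w = \<one>\<^bsub>G\<^esub>)"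

end

theory Submission
  imports Defs "HOL-Algebra.Group_Action"
begin

text \<open>
  Let a group act so that for every finite set \<open>Y\<close> and every point \<open>x \<notin> Y\<close> some element
  fixes \<open>Y\<close> pointwise and moves \<open>x\<close>. Given a reduced word, the group elements are
  constructed letter by letter so that some point has a trajectory under the suffixes of the
  word without repetitions. When a letter \<open>x\<^sub>i\<close> is added whose inverse sends the endpoint of the
  trajectory to \<open>q\<close>, the value of \<open>x\<^sub>i\<close> is corrected by an element that moves \<open>q\<close> and fixes all
  other points of the trajectory. The earlier steps survive: a step by \<open>x\<^sub>i\<close> could only be
  affected if it were the last one and cancelled against the new letter. Thompson's group has
  this separation property on the open unit interval because of bumps with small support.
\<close>

text \<open>An inverse letter is read as a forward equation for \<open>a (fst l)\<close>, so both
  signs constrain one map and no group inverse occurs.\<close>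

definition letter_step :: "('g \<Rightarrow> 'b \<Rightarrow> 'b) \<Rightarrow> (nat \<Rightarrow> 'g) \<Rightarrow> nat \<times> bool \<Rightarrow> 'b \<Rightarrow> 'b \<Rightarrow> bool" where
  "letter_step \<phi> a l x y \<longleftrightarrow>
     (if snd l then \<phi> (a (fst l)) x = y else \<phi> (a (fst l)) y = x)"

section \<open>Trajectories of reduced words under a separating action\<close>

context group_action
begin

lemma word_value_closed:
  assumes "range a \<subseteq> carrier G"
  shows "word_value G a w \<in> carrier G"
proof -
  interpret group G using group_hom by (rule group_hom.axioms(1))
  show ?thesis
    using assms by (induction w) (auto simp: image_subset_iff)
qed

text \<open>The rightmost letter acts first, so a trajectory starts at \<open>p (length w)\<close>
  and ends at \<open>p 0\<close>.\<close>

lemma word_value_steps: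
  assumes a: "range a \<subseteq> carrier G"
    and "\<And>m. p m \<in> E"
    and "\<And>m. m < length w \<Longrightarrow> letter_step \<phi> a (w ! m) (p (Suc m)) (p m)"
  shows "\<phi> (word_value G a w) (p (length w)) = p 0"
  using assms(2,3)
proof (induction w arbitrary: p)
  case Nil
  then show ?case by (simp flip: id_eq_one)
next
  case (Cons l w)
  interpret group G using group_hom by (rule group_hom.axioms(1))
  obtain i e where l: "l = (i, e)" by fastforce
  have ai: "a i \<in> carrier G" using a by auto
  have "letter_step \<phi> a (w ! m) (p (Suc (Suc m))) (p (Suc m))" if "m < length w" for m
    using Cons.prems(2)[of "Suc m"] that by simp
  with Cons.IH[of "\<lambda>m. p (Suc m)"] Cons.prems(1)
  have IH: "\<phi> (word_value G a w) (p (Suc (length w))) = p 1" by simp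
  have "\<phi> (if e then a i else inv a i) (p 1) = p 0"
    using Cons.prems(2)[of 0] Cons.prems(1) ai orbit_sym_aux
    by (auto simp: letter_step_def l)
  with IH show ?case
    using composition_rule[OF Cons.prems(1)] word_value_closed[OF a] ai by (simp add: l)
qed

text \<open>Only distinct endpoints are wanted in the end, but the induction needs injectivity of
  the whole trajectory. Words grow on the right: a new letter prolongs the trajectory backwards, by
  a preimage of its starting point.\<close>

lemma separating_action_trajectory:
  assumes x0: "x0 \<in> D" and D: "D \<subseteq> E"
    and invar: "\<And>g x. g \<in> carrier G \<Longrightarrow> x \<in> D \<Longrightarrow> \<phi> g x \<in> D"
    and separating: "\<And>x Y. finite Y \<Longrightarrow> Y \<subseteq> D \<Longrightarrow> x \<in> D - Y \<Longrightarrow>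
      \<exists>g\<in>carrier G. (\<forall>y\<in>Y. \<phi> g y = y) \<and> \<phi> g x \<noteq> x"
    and "reduced w"
  shows "\<exists>a p. range a \<subseteq> carrier G \<and> range p \<subseteq> D \<and> inj_on p {..length w} \<and>
    (\<forall>m<length w. letter_step \<phi> a (w ! m) (p (Suc m)) (p m))"
  using \<open>reduced w\<close>
proof (induction w rule: rev_induct)
  case Nil
  interpret group G using group_hom by (rule group_hom.axioms(1))
  show ?case
    by (rule exI[of _ "\<lambda>_. \<one>"], rule exI[of _ "\<lambda>_. x0"]) (use x0 in auto)
next
  case (snoc l w)
  interpret group G using group_hom by (rule group_hom.axioms(1))
  obtain i e where l: "l = (i, e)" by fastforce
  define k where "k = length w"
  have red: "reduced w" and no_cancel: "w = [] \<or> last w \<noteq> (i, \<not> e)"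
    using snoc.prems by (auto simp: reduced_def successively_append_iff l)
  obtain a p where a: "range a \<subseteq> carrier G" and p: "range p \<subseteq> D"
    and inj: "inj_on p {..k}"
    and steps: "\<And>m. m < k \<Longrightarrow> letter_step \<phi> a (w ! m) (p (Suc m)) (p m)"
    using snoc.IH[OF red] unfolding k_def by blast
  have ai: "a i \<in> carrier G" using a by auto
  have pD: "p m \<in> D" and pE: "p m \<in> E" for m using p D by auto
  \<comment> \<open>The preimage of \<open>p k\<close> under the new letter for the old values; it
    may already lie on the trajectory.\<close>
  define q where "q = \<phi> (if e then inv a i else a i) (p k)"
  have qD: "q \<in> D" using ai pD by (auto simp: q_def intro!: invar)
  then have qE: "q \<in> E" using D by auto
  have q: "if e then \<phi> (a i) q = p k else \<phi> (a i) (p k) = q"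
    using ai pE orbit_sym_aux[of "inv a i" "p k" q] by (auto simp: q_def)
  define Y where "Y = p ` {..k} - {q}"
  have "finite Y" "Y \<subseteq> D" "q \<in> D - Y" using pD qD by (auto simp: Y_def)
  from separating[OF this] obtain h where h: "h \<in> carrier G"
    and fix_Y: "\<And>y. y \<in> Y \<Longrightarrow> \<phi> h y = y" and move: "\<phi> h q \<noteq> q" by blast
  have fix_p: "\<phi> h (p m) = p m" if "m \<le> k" "p m \<noteq> q" for m
    using that by (intro fix_Y) (auto simp: Y_def)
  define r where "r = \<phi> h q"
  have rD: "r \<in> D" using h qD by (simp add: r_def invar)
  then have rE: "r \<in> E" using D by auto
  \<comment> \<open>Since \<open>r\<close> differs from \<open>q\<close>, being on the trajectory
    would make it a fixed point of \<open>h\<close>; then \<open>h\<close> would send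
    \<open>r\<close> and \<open>q\<close> to the same point.\<close>
  have r_new: "r \<notin> p ` {..k}"
  proof
    assume "r \<in> p ` {..k}"
    then have "\<phi> h r = r" using move by (auto simp: r_def intro: fix_p)
    then have "\<phi> h r = \<phi> h q" by (simp add: r_def)
    then have "r = q" using inj_prop[OF h] rE qE by (simp add: inj_on_eq_iff)
    with move show False by (simp add: r_def)
  qed
  \<comment> \<open>The side of the factor depends on the sign: in both cases the new letter now
    takes \<open>r\<close>, instead of \<open>q\<close>, to \<open>p k\<close>.\<close>
  define b where "b = a(i := if e then a i \<otimes> inv h else h \<otimes> a i)"
  define p' where "p' = p(Suc k := r)"
  have b: "range b \<subseteq> carrier G" using a ai h by (auto simp: b_def)
  have steps': "letter_step \<phi> b (w ! m) (p (Suc m)) (p m)" if m: "m < k" for m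
  proof (cases "fst (w ! m) = i")
    case False
    then show ?thesis using steps[OF m] by (simp add: letter_step_def b_def)
  next
    case True
    \<comment> \<open>Orients the step so that \<open>a i\<close> takes \<open>p s\<close> to
      \<open>p t\<close>, whatever the sign of the letter.\<close>
    define s where "s = (if snd (w ! m) then Suc m else m)"
    define t where "t = (if snd (w ! m) then m else Suc m)"
    have st: "s \<le> k" "t \<le> k" using m by (auto simp: s_def t_def)
    have step: "\<phi> (a i) (p s) = p t"
      using steps[OF m] True by (simp add: letter_step_def s_def t_def split: if_splits)
    have last: "w ! m = (i, e)" if "Suc m = k"
    proof -
      have "w \<noteq> []" using m by (auto simp: k_def)
      moreover from this have "last w = w ! m"
        using that by (auto simp: k_def last_conv_nth dest: sym)
      ultimately show ?thesis using no_cancel True by (cases "w ! m") auto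
    qed
    have "\<phi> (b i) (p s) = p t"
    proof (cases e)
      case True
      \<comment> \<open>Otherwise \<open>a i\<close> takes \<open>p s\<close> to \<open>p k\<close>,
        so \<open>t = k\<close>: the step belongs to the last letter of \<open>w\<close> and that
        letter is inverse, which reducedness excludes.\<close>
      have "p s \<noteq> q"
      proof
        assume "p s = q"
        then have "p t = p k" using q step True by simp
        then have "t = k" using inj st by (auto simp: inj_on_def)
        then show False using last m True by (auto simp: t_def split: if_splits)
      qed
      then have "\<phi> (inv h) (p s) = p s"
        using fix_p st h pE orbit_sym_aux by blast
      then show ?thesis using True step composition_rule[OF pE] ai h by (simp add: b_def)
    next
      case False
      \<comment> \<open>Dual case: here \<open>s = k\<close> would make the last letter of
        \<open>w\<close> positive, against the negative new letter.\<close>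
      have "p t \<noteq> q"
      proof
        assume "p t = q"
        then have "\<phi> (a i) (p s) = \<phi> (a i) (p k)" using q step False by simp
        then have "p s = p k" using inj_prop[OF ai] pE by (simp add: inj_on_eq_iff)
        then have "s = k" using inj st by (auto simp: inj_on_def)
        then show False using last m False by (auto simp: s_def split: if_splits)
      qed
      then show ?thesis
        using False step composition_rule[OF pE] ai h fix_p st by (simp add: b_def)
    qed
    then show ?thesis using True by (simp add: letter_step_def s_def t_def split: if_splits)
  qed
  have new_step: "letter_step \<phi> b l r (p k)"
  proof (cases e)
    case True
    have "\<phi> (inv h) r = q" using h qE orbit_sym_aux by (simp add: r_def)
    then show ?thesis using True q composition_rule[OF rE] ai h
      by (simp add: letter_step_def l b_def)
  next
    case False
    then show ?thesis using q composition_rule[OF pE] ai h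
      by (simp add: letter_step_def l b_def r_def)
  qed
  have "letter_step \<phi> b ((w @ [l]) ! m) (p' (Suc m)) (p' m)" if "m < length (w @ [l])" for m
    using that steps'[of m] new_step by (auto simp: p'_def nth_append k_def less_Suc_eq)
  moreover have "inj_on p' {..length (w @ [l])}"
  proof -
    have "inj_on p' {..k}" using inj by (simp add: p'_def inj_on_def)
    moreover have "p' ` {..k} = p ` {..k}" by (auto simp: p'_def)
    ultimately show ?thesis using r_new
      by (auto simp: k_def[symmetric] atMost_Suc p'_def)
  qed
  moreover have "range p' \<subseteq> D" using p rD by (auto simp: p'_def)
  ultimately show ?case using b by blast
qed

lemma separating_action_no_identity:
  assumes "x0 \<in> D" and D: "D \<subseteq> E"
    and "\<And>g x. g \<in> carrier G \<Longrightarrow> x \<in> D \<Longrightarrow> \<phi> g x \<in> D"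
    and "\<And>x Y. finite Y \<Longrightarrow> Y \<subseteq> D \<Longrightarrow> x \<in> D - Y \<Longrightarrow>
      \<exists>g\<in>carrier G. (\<forall>y\<in>Y. \<phi> g y = y) \<and> \<phi> g x \<noteq> x"
    and w: "nontrivial_reduced_word n w"
  shows "\<not> satisfies_identity G n w"
proof -
  have "reduced w" "w \<noteq> []" using w by (auto simp: nontrivial_reduced_word_def)
  from separating_action_trajectory[OF assms(1-4) this(1)] obtain a p
    where a: "range a \<subseteq> carrier G" and p: "range p \<subseteq> D" and inj: "inj_on p {..length w}"
      and steps: "\<And>m. m < length w \<Longrightarrow> letter_step \<phi> a (w ! m) (p (Suc m)) (p m)"
    by blast
  have pE: "p m \<in> E" for m using p D by auto
  have "p 0 \<noteq> p (length w)"
    using inj_onD[OF inj, of 0 "length w"] \<open>w \<noteq> []\<close> by auto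
  then have "word_value G a w \<noteq> \<one>"
    using word_value_steps[OF a pE steps] pE by (auto simp flip: id_eq_one)
  with a show ?thesis by (auto simp: satisfies_identity_def)
qed

end

section \<open>Dyadic bumps with small support\<close>

lemma dyadic_of_int_divide: "of_int m / 2 ^ n \<in> dyadic_rationals"
  unfolding dyadic_rationals_def by blast

text \<open>
  The map below has slope 2 on \<open>[c, c + d]\<close>, slope 1/2 on \<open>[c + d, c + 3d]\<close>, and is the identity
  elsewhere.
\<close>

definition dyadic_bump :: "real \<Rightarrow> real \<Rightarrow> real \<Rightarrow> real" where
  "dyadic_bump c d = (\<lambda>x\<in>{0..1}. max x (min (2 * x - c) ((x + c + 3 * d) / 2)))"

lemma dyadic_bump_in_thompson_F:
  assumes c: "c \<in> dyadic_rationals" and d: "d \<in> dyadic_rationals"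
    and le: "0 \<le> c" "0 < d" "c + 3 * d \<le> 1"
  shows "dyadic_bump c d \<in> thompson_F_set"
proof -
  let ?h = "\<lambda>x. max x (min (2 * x - c) ((x + c + 3 * d) / 2))"
  \<comment> \<open>Inverting increasing maps exchanges \<open>max\<close> and \<open>min\<close>,
    so each affine piece is simply replaced by its inverse.\<close>
  let ?g = "\<lambda>y. min y (max ((y + c) / 2) (2 * y - c - 3 * d))"
  have "homeomorphism {0..1} {0..1} ?h ?g"
  proof (rule homeomorphismI)
    show "continuous_on {0..1} ?h" "continuous_on {0..1} ?g"
      by (intro continuous_intros; simp)+
    show "?h ` {0..1} \<subseteq> {0..1}" "?g ` {0..1} \<subseteq> {0..1}"
      using le by (auto simp: max_def min_def)
    show "?g (?h x) = x" "?h (?g x) = x" for x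
      using le by (auto simp: max_def min_def field_simps)
  qed
  then have hom: "homeomorphism {0..1} {0..1} (dyadic_bump c d) ?g"
    by (rule homeomorphism_cong) (auto simp: dyadic_bump_def)
  then have "dyadic_bump c d ` {0..1} = {0..1}" "inj_on (dyadic_bump c d) {0..1}"
    by (auto simp: homeomorphism_def intro: inj_on_inverseI)
  then have "dyadic_bump c d \<in> Bij {0..1}"
    by (simp add: Bij_def bij_betw_def dyadic_bump_def)
  moreover have "strict_mono_on {0..1} (dyadic_bump c d)"
    by (auto simp: strict_mono_on_def dyadic_bump_def max_def min_def)
  moreover have "dyadic_piecewise_linear (dyadic_bump c d)"
  proof (rule dyadic_piecewise_linearI)
    show "finite {c, c + d, c + 3 * d}" by simp
    show "{c, c + d, c + 3 * d} \<subseteq> dyadic_rationals"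
      using dyadic_add[OF c d] dyadic_add[OF c dyadic_add[OF d dyadic_add[OF d d]]] c by simp
    fix a b :: real
    assume ab: "0 \<le> a" "a < b" "b \<le> 1" "{a<..<b} \<inter> {c, c + d, c + 3 * d} = {}"
    then consider "b \<le> c" | "c \<le> a" "b \<le> c + d" | "c + d \<le> a" "b \<le> c + 3 * d"
      | "c + 3 * d \<le> a"
      by fastforce
    then show "\<exists>(k::int) e. \<forall>x\<in>{a..b}. dyadic_bump c d x = 2 powi k * x + e"
    proof cases
      case 1
      then show ?thesis using ab le
        by (intro exI[of _ 0]) (auto simp: dyadic_bump_def max_def min_def)
    next
      case 2
      then show ?thesis using ab le
        by (intro exI[of _ 1] exI[of _ "- c"]) (auto simp: dyadic_bump_def max_def min_def)
    next
      case 3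
      then show ?thesis using ab le
        by (intro exI[of _ "-1"] exI[of _ "(c + 3 * d) / 2"])
          (auto simp: dyadic_bump_def max_def min_def field_simps)
    next
      case 4
      then show ?thesis using ab le
        by (intro exI[of _ 0]) (auto simp: dyadic_bump_def max_def min_def)
    qed
  qed
  ultimately show ?thesis using hom by (auto simp: thompson_F_set_def)
qed

text \<open>A bump moves exactly the points strictly between \<open>c\<close> and
  \<open>c + 3 * d\<close>; this interval is placed around \<open>x\<close> and made too short to
  reach \<open>Y\<close>.\<close>

lemma thompson_F_separating:
  assumes Y: "finite Y" "Y \<subseteq> {0<..<1}" and x: "x \<in> {0<..<1} - Y"
  shows "\<exists>g\<in>thompson_F_set. (\<forall>y\<in>Y. g y = y) \<and> g x \<noteq> x"
proof -
  \<comment> \<open>Avoiding 0 and 1 as well keeps the support of the bump inside the unit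
    interval.\<close>
  have "finite (insert 0 (insert 1 Y))" using Y by simp
  from finite_set_avoid[OF this, of x] obtain r where r: "r > 0"
    and avoid: "\<And>y. y \<in> insert 0 (insert 1 Y) \<Longrightarrow> y \<noteq> x \<Longrightarrow> r \<le> dist x y" by blast
  obtain n where n: "(1 / 2) ^ n < r / 3" using real_arch_pow_inv[of "r / 3" "1 / 2"] r by auto
  define d :: real where "d = 1 / 2 ^ n"
  have d: "0 < d" "3 * d < r" using n by (auto simp: d_def power_divide)
  \<comment> \<open>The shift by one grid step puts \<open>x\<close> in the middle third of the
    support; without it a dyadic \<open>x\<close> could equal the fixed point
    \<open>c\<close>.\<close>
  define c where "c = of_int (\<lfloor>x * 2 ^ n\<rfloor> - 1) / (2 ^ n :: real)"
  have "of_int \<lfloor>x * 2 ^ n\<rfloor> / 2 ^ n \<le> x" "x < (of_int \<lfloor>x * 2 ^ n\<rfloor> + 1) / 2 ^ n"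
    using floor_correct[of "x * 2 ^ n"] by (simp_all add: field_simps)
  then have cx: "c + d \<le> x" "x < c + 2 * d"
    by (simp_all add: c_def d_def add_divide_distrib diff_divide_distrib)
  have x01: "r \<le> x" "r \<le> 1 - x" using avoid[of 0] avoid[of 1] x by (auto simp: dist_real_def)
  have "dyadic_bump c d \<in> thompson_F_set"
    using dyadic_of_int_divide[of "\<lfloor>x * 2 ^ n\<rfloor> - 1" n] dyadic_of_int_divide[of 1 n] cx d x01
    by (intro dyadic_bump_in_thompson_F) (auto simp: c_def d_def)
  moreover have "dyadic_bump c d y = y" if "y \<in> Y" for y
  proof -
    have "r \<le> \<bar>x - y\<bar>" using avoid[of y] that x by (auto simp: dist_real_def)
    then show ?thesis using that Y(2) cx d
      by (auto simp: dyadic_bump_def max_def min_def abs_if split: if_splits)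
  qed
  moreover have "dyadic_bump c d x \<noteq> x"
    using x cx d by (auto simp: dyadic_bump_def max_def min_def)
  ultimately show ?thesis by blast
qed

text \<open>Elements of the group are already permutations of the interval, so the action is the
  inclusion into \<open>BijGroup\<close>.\<close>

lemma thompson_F_action: "group_action thompson_F {0..1} id"
  unfolding group_action_def thompson_F_def
  using group.canonical_inj_is_hom[OF group_BijGroup subgroup_thompson_F] .

text \<open>Every element fixes 0 and 1, so points can be separated only in the open interval; this
  gives the invariance required of \<open>D\<close> there.\<close>

lemma thompson_F_interior:
  assumes f: "f \<in> thompson_F_set" and x: "x \<in> {0<..<1}"
  shows "f x \<in> {0<..<1}"
proof -
  have m: "strict_mono_on {0..1} f" and "f ` {0..1} = {0..1}"
    using f by (auto simp: thompson_F_set_def Bij_def bij_betw_def)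
  then have "f 0 \<in> {0..1}" "f 1 \<in> {0..1}" by force+
  moreover have "f 0 < f x" "f x < f 1"
    using x strict_mono_onD[OF m, of 0 x] strict_mono_onD[OF m, of x 1] by auto
  ultimately show ?thesis by auto
qed

lemma thompson_F_no_identity:
  assumes "nontrivial_reduced_word n w"
  shows "\<not> satisfies_identity thompson_F n w"
proof (rule group_action.separating_action_no_identity[OF thompson_F_action])
  have carrier: "carrier thompson_F = thompson_F_set" by (simp add: thompson_F_def)
  show "(1 / 2 :: real) \<in> {0<..<1}" "{0<..<1} \<subseteq> {0..1::real}" by auto
  show "id g x \<in> {0<..<1}" if "g \<in> carrier thompson_F" "x \<in> {0<..<1}" for g x
    using that thompson_F_interior by (simp add: carrier)
  show "\<exists>g\<in>carrier thompson_F. (\<forall>y\<in>Y. id g y = y) \<and> id g x \<noteq> x"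
    if "finite Y" "Y \<subseteq> {0<..<1}" "x \<in> {0<..<1} - Y" for x Y
    using thompson_F_separating[OF that] by (simp add: carrier)
qed (fact assms)

theorem lemma6:
  shows "\<not> (\<exists>n w. n \<ge> 1 \<and> nontrivial_reduced_word n w \<and> satisfies_identity thompson_F n w) \<and>
    (\<forall>n w. n \<ge> 1 \<and> nontrivial_reduced_word n w \<longrightarrow>
      (\<exists>a \<in> {1..n} \<rightarrow> carrier thompson_F. word_value thompson_F a w \<noteq> \<one>\<^bsub>thompson_F\<^esub>))"
  using thompson_F_no_identity unfolding satisfies_identity_def by blast

end
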